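(* Let $n\ge 1$, let $\mathbf{H}\in\mathbb{R}^{n\times n}$ have non-negative entries, let $\mathbf{P}\in\mathbb{R}^{n\times n}$, let $\mathbf{b}\in\mathbb{R}^n$ have non-negative entries, and let $r>0$, $\sigma^2>0$, $\varsigma^2>0$. Consider the function of $\mathbf{G}\in\mathbb{R}^{n\times n}$ $$\mathrm{MSE}(\mathbf{G})= n r+r\,\mathrm{tr}(\mathbf{H}\mathbf{P}\mathbf{P}^T\mathbf{H}^T\mathbf{G}^T\mathbf{G})-r\,\mathrm{tr}(\mathbf{G}\mathbf{H}\mathbf{P})-r\,\mathrm{tr}(\mathbf{P}^T\mathbf{H}^T\mathbf{G}^T)+\sigma^2\mathrm{tr}(\mathbf{G}^T\mathbf{G})+\varsigma^2\sigma^2\,\mathrm{tr}\{\mathrm{diag}(\mathbf{H}\mathbf{b})\mathbf{G}^T\mathbf{G}\}.$$ Then the minimizer of $\mathrm{MSE}(\mathbf{G})$ over $\mathbf{G}\in\mathbb{R}^{n\times n}$ is $$\mathbf{G}=r\mathbf{P}^{T}\mathbf{H}^T\big(r\mathbf{H}\mathbf{P}\mathbf{P}^{T}\mathbf{H}^T+\sigma^2\varsigma^2\,\mathrm{diag}(\mathbf{H}\mathbf{b})+\sigma^2\mathbf{I}\big)^{-1}.$$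
   Context: For a vector $\mathbf{v}\in\mathbb{R}^n$, $\mathrm{diag}(\mathbf{v})$ is the $n\times n$ diagonal matrix with diagonal entries $v_1,\dots,v_n$; $\mathbf{I}$ is the identity matrix. Here $n=3N_t$, where $N_t$ is the number of RGB LEDs; $\mathbf{H}$ is the optical channel matrix, $\mathbf{P}$ the precoder, $\mathbf{b}$ the DC offset, $\mathbf{G}$ the linear post-equalizer, $r$ the signal variance, $\sigma^2$ the thermal noise variance, and $\varsigma^2$ the shot noise scaling factor. *)

theory Defs
  imports "HOL-Analysis.Analysis"
begin

definition diag :: "real ^ 'n \<Rightarrow> real ^ 'n ^ 'n" where
  "diag v = (\<chi> i j. if i = j then v $ i else 0)"

definition MSE :: "real ^ 'n ^ 'n \<Rightarrow> real ^ 'n ^ 'n \<Rightarrow> real ^ 'n \<Rightarrow> real \<Rightarrow> real \<Rightarrow> real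
    \<Rightarrow> real ^ 'n ^ 'n \<Rightarrow> real" where
  "MSE H P b r \<sigma> varsigma G =
     real CARD('n) * r
     + r * trace (H ** P ** transpose P ** transpose H ** transpose G ** G)
     - r * trace (G ** H ** P)
     - r * trace (transpose P ** transpose H ** transpose G)
     + \<sigma>\<^sup>2 * trace (transpose G ** G)
     + varsigma\<^sup>2 * \<sigma>\<^sup>2 * trace (diag (H *v b) ** transpose G ** G)"

end

theory Submission
  imports Defs
begin

text \<open>
  Write \<open>M\<close> for the matrix to be inverted; it is symmetric and positive definite, its \<open>\<sigma>\<^sup>2 I\<close> part
  being so and the other two parts being positive semidefinite. With
  \<open>G\<^sub>0 M = r P\<^sup>T H\<^sup>T\<close>, cyclicity of the trace and completing the square give
  \<open>MSE(G) = n r + tr((G - G\<^sub>0) M (G - G\<^sub>0)\<^sup>T) - tr(G\<^sub>0 M G\<^sub>0\<^sup>T)\<close>, and the middle term is the sum of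
  the values of the quadratic form of \<open>M\<close> at the rows of \<open>G - G\<^sub>0\<close>.
\<close>

lemma trace_scaleR: "trace (c *\<^sub>R A) = c * trace (A :: real ^ 'n ^ 'n)"
  by (simp add: trace_def sum_distrib_left)

lemma matrix_add_rdistrib: "(A + B) ** C = A ** C + B ** (C :: 'a::semiring_1 ^ 'n ^ 'm)"
  by (simp add: matrix_matrix_mult_def vec_eq_iff distrib_right sum.distrib)

lemma matrix_diff_rdistrib: "(A - B) ** C = A ** C - B ** (C :: 'a::ring_1 ^ 'n ^ 'm)"
  by (simp add: matrix_matrix_mult_def vec_eq_iff left_diff_distrib sum_subtractf)

lemma matrix_diff_ldistrib: "A ** (B - C) = A ** B - A ** (C :: 'a::ring_1 ^ 'n ^ 'm)"
  by (simp add: matrix_matrix_mult_def vec_eq_iff right_diff_distrib sum_subtractf)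

lemma matrix_inv_left:
  assumes "invertible A"
  shows "matrix_inv A ** A = mat 1"
  \<comment> \<open>\<open>matrix_inv\<close> is a choice among two-sided inverses; invertibility
    supplies the witness.\<close>
  using assms unfolding invertible_def matrix_inv_def by (rule someI2_ex) simp

lemma transpose_add: "transpose (A + B) = transpose A + transpose (B :: 'a::plus ^ 'n ^ 'm)"
  by (simp add: transpose_def vec_eq_iff)

lemma transpose_diff: "transpose (A - B) = transpose A - transpose (B :: 'a::minus ^ 'n ^ 'm)"
  by (simp add: transpose_def vec_eq_iff)

lemma transpose_diag: "transpose (diag v) = diag v"
  by (simp add: transpose_def diag_def vec_eq_iff)

lemma trace_transpose: "trace (transpose A) = trace A"
  by (simp add: trace_def transpose_def)

lemma trace_mul_cyclic:
  fixes A B C :: "real ^ 'n ^ 'n"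
  shows "trace (A ** B ** C) = trace (C ** A ** B)"
  by (metis trace_mul_sym matrix_mul_assoc)

lemma inner_diag_mult_nonneg:
  assumes "\<And>i. 0 \<le> v $ i"
  shows "0 \<le> x \<bullet> (diag v *v x)"
proof -
  have "(diag v *v x) $ i = v $ i * x $ i" for i
    by (simp add: diag_def matrix_vector_mult_def if_distrib [where f = "\<lambda>c. c * _"] cong: if_cong)
  then have "x \<bullet> (diag v *v x) = (\<Sum>i\<in>UNIV. v $ i * (x $ i)\<^sup>2)"
    by (simp add: inner_vec_def power2_eq_square algebra_simps)
  also have "\<dots> \<ge> 0"
    using assms by (intro sum_nonneg) auto
  finally show ?thesis .
qed

text \<open>Moving \<open>K\<close> across the inner product turns the form into the squared norm of
  \<open>transpose K *v x\<close>.\<close>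

lemma inner_mult_transpose_nonneg:
  fixes K :: "real ^ 'm ^ 'n"
  shows "0 \<le> x \<bullet> ((K ** transpose K) *v x)"
proof -
  have "x \<bullet> ((K ** transpose K) *v x) = (transpose K *v x) \<bullet> (transpose K *v x)"
    by (simp add: dot_lmul_matrix flip: matrix_vector_mul_assoc)
  then show ?thesis
    by simp
qed

lemma trace_congruence_eq_sum_inner:
  fixes D M :: "real ^ 'n ^ 'n"
  shows "trace (D ** M ** transpose D) = (\<Sum>i\<in>UNIV. D $ i \<bullet> (M *v D $ i))"
proof -
  have "D ** M ** transpose D = D ** (M ** transpose D)"
    by (simp add: matrix_mul_assoc)
  then show ?thesis
    by (simp add: trace_def matrix_matrix_mult_def matrix_vector_mult_def transpose_def inner_vec_def)
qed

text \<open>A nonzero kernel vector would give the form the value 0; for a square matrix a trivial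
  kernel suffices.\<close>

lemma invertible_if_posdef:
  fixes M :: "real ^ 'n ^ 'n"
  assumes "\<And>x. x \<noteq> 0 \<Longrightarrow> 0 < x \<bullet> (M *v x)"
  shows "invertible M"
proof -
  have "x = 0" if "M *v x = 0" for x
    using assms[of x] that by force
  then show ?thesis
    by (metis matrix_left_invertible_ker invertible_left_inverse)
qed

text \<open>Some row of \<open>D\<close> is nonzero and contributes a positive value, while no row
  contributes a negative one. The strictness is what makes the minimizer unique.\<close>

lemma trace_congruence_pos:
  fixes D M :: "real ^ 'n ^ 'n"
  assumes "\<And>x. x \<noteq> 0 \<Longrightarrow> 0 < x \<bullet> (M *v x)" and "D \<noteq> 0"
  shows "0 < trace (D ** M ** transpose D)"
proof -
  obtain i where "D $ i \<noteq> 0"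
    using \<open>D \<noteq> 0\<close> by (auto simp: vec_eq_iff)
  moreover have "0 \<le> D $ j \<bullet> (M *v D $ j)" for j
    using assms(1)[of "D $ j"] by (cases "D $ j = 0") auto
  ultimately show ?thesis
    unfolding trace_congruence_eq_sum_inner using assms(1) by (intro sum_pos2[of _ i]) auto
qed

text \<open>The two cross terms are traces of mutually transposed matrices, because \<open>M\<close>
  is symmetric, so they merge into one doubled term.\<close>

lemma trace_complete_square:
  fixes G G\<^sub>0 M :: "real ^ 'n ^ 'n"
  assumes "transpose M = M"
  shows "trace (G ** M ** transpose G) - 2 * trace (G\<^sub>0 ** M ** transpose G)
    = trace ((G - G\<^sub>0) ** M ** transpose (G - G\<^sub>0)) - trace (G\<^sub>0 ** M ** transpose G\<^sub>0)"
proof -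
  have "trace (G ** M ** transpose G\<^sub>0) = trace (G\<^sub>0 ** M ** transpose G)"
    using trace_transpose[of "G ** M ** transpose G\<^sub>0"] assms
    by (simp add: matrix_transpose_mul matrix_mul_assoc)
  then show ?thesis
    by (simp add: transpose_diff trace_sub matrix_diff_ldistrib matrix_diff_rdistrib)
qed

text \<open>Cyclicity brings the signal, shot noise and thermal noise terms to the common shape
  \<open>G ** N ** transpose G\<close>; the two linear terms agree by transposition.\<close>

lemma MSE_eq_quadratic:
  fixes H P G :: "real ^ 'n ^ 'n"
  shows "MSE H P b r \<sigma> varsigma G = real CARD('n) * r
    + trace (G ** (r *\<^sub>R (H ** P ** transpose P ** transpose H)
        + (\<sigma>\<^sup>2 * varsigma\<^sup>2) *\<^sub>R diag (H *v b) + \<sigma>\<^sup>2 *\<^sub>R mat 1) ** transpose G)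
    - 2 * trace (r *\<^sub>R (transpose P ** transpose H) ** transpose G)"
proof -
  have "trace (G ** H ** P) = trace (transpose P ** transpose H ** transpose G)"
    using trace_transpose[of "G ** H ** P"] by (simp add: matrix_transpose_mul matrix_mul_assoc)
  moreover have "trace (transpose G ** G) = trace (G ** transpose G)"
    by (rule trace_mul_sym)
  moreover have "trace (N ** transpose G ** G) = trace (G ** N ** transpose G)" for N
    by (rule trace_mul_cyclic)
  ultimately show ?thesis
    by (simp add: MSE_def matrix_add_ldistrib matrix_add_rdistrib trace_add trace_scaleR
        matrix_scalar_ac flip: scalar_matrix_assoc)
qed

theorem mainTheorem1:
  fixes H P :: "real ^ 'n ^ 'n"
    and b :: "real ^ 'n"
    and r \<sigma> varsigma :: real
  assumes "\<And>i j. 0 \<le> H $ i $ j"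
    and "\<And>i. 0 \<le> b $ i"
    and "r > 0" and "\<sigma>\<^sup>2 > 0" and "varsigma\<^sup>2 > 0"
  defines "M \<equiv> r *\<^sub>R (H ** P ** transpose P ** transpose H)
                + (\<sigma>\<^sup>2 * varsigma\<^sup>2) *\<^sub>R diag (H *v b) + \<sigma>\<^sup>2 *\<^sub>R mat 1"
  shows "invertible M \<and>
    (\<forall>G. is_arg_min (MSE H P b r \<sigma> varsigma) (\<lambda>_. True) G \<longleftrightarrow>
         G = (r *\<^sub>R (transpose P ** transpose H)) ** matrix_inv M)"
proof -
  have gram: "H ** P ** transpose P ** transpose H = (H ** P) ** transpose (H ** P)"
    by (simp add: matrix_transpose_mul matrix_mul_assoc)
  have sym: "transpose M = M"
    by (simp add: M_def gram transpose_add transpose_scalar transpose_diag transpose_mat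
        matrix_transpose_mul)
  have posdef: "0 < x \<bullet> (M *v x)" if "x \<noteq> 0" for x
  proof -
    \<comment> \<open>Non-negativity of \<open>H\<close> and \<open>b\<close> makes the shot noise
      part positive semidefinite.\<close>
    have "0 \<le> (H *v b) $ i" for i
      unfolding matrix_vector_mult_def using assms(1,2) by (auto intro!: sum_nonneg)
    then have "0 \<le> x \<bullet> (diag (H *v b) *v x)"
      by (rule inner_diag_mult_nonneg)
    moreover have "0 \<le> x \<bullet> ((H ** P ** transpose P ** transpose H) *v x)"
      unfolding gram by (rule inner_mult_transpose_nonneg)
    \<comment> \<open>Scaled by \<open>\<sigma>\<^sup>2 > 0\<close>, the identity part makes the
      whole form strictly positive.\<close>
    moreover have "0 < x \<bullet> x"
      using that by simp
    moreover have "x \<bullet> (M *v x) = r * (x \<bullet> ((H ** P ** transpose P ** transpose H) *v x))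
        + (\<sigma>\<^sup>2 * varsigma\<^sup>2) * (x \<bullet> (diag (H *v b) *v x)) + \<sigma>\<^sup>2 * (x \<bullet> x)"
      by (simp add: M_def matrix_vector_mult_add_rdistrib inner_add_right
          flip: scaleR_matrix_vector_assoc)
    ultimately show ?thesis
      using assms(3-5) by (simp add: add_nonneg_pos)
  qed
  have inv: "invertible M"
    using posdef by (rule invertible_if_posdef)
  define G\<^sub>0 where "G\<^sub>0 = (r *\<^sub>R (transpose P ** transpose H)) ** matrix_inv M"
  \<comment> \<open>This rewrites the linear term of the MSE as
    \<open>trace (G\<^sub>0 ** M ** transpose G)\<close>, ready for completing the square.\<close>
  have "G\<^sub>0 ** M = r *\<^sub>R (transpose P ** transpose H)"
    using inv by (simp add: G\<^sub>0_def matrix_inv_left flip: matrix_mul_assoc)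
  then have MSE: "MSE H P b r \<sigma> varsigma G = real CARD('n) * r
      + trace ((G - G\<^sub>0) ** M ** transpose (G - G\<^sub>0)) - trace (G\<^sub>0 ** M ** transpose G\<^sub>0)" for G
    using trace_complete_square[OF sym, of G G\<^sub>0] MSE_eq_quadratic[of H P b r \<sigma> varsigma G]
    by (simp add: M_def)
  have less: "MSE H P b r \<sigma> varsigma G\<^sub>0 < MSE H P b r \<sigma> varsigma G" if "G \<noteq> G\<^sub>0" for G
    using trace_congruence_pos[OF posdef, of "G - G\<^sub>0"] that
    by (simp add: MSE trace_def)
  \<comment> \<open>Strictness serves both directions: nothing beats \<open>G\<^sub>0\<close>, and
    \<open>G\<^sub>0\<close> beats every other \<open>G\<close>.\<close>
  have "is_arg_min (MSE H P b r \<sigma> varsigma) (\<lambda>_. True) G \<longleftrightarrow> G = G\<^sub>0" for G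
    unfolding is_arg_min_def using less by (metis less_asym)
  with inv show ?thesis
    by (simp add: G\<^sub>0_def)
qed

end
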